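(* Let $n\ge1$, $h\ge 3$, let $E$ be a $\mathrm{SLIP}_n^h$ measure, and let $|\psi\rangle,|\phi\rangle\in(\mathbb C^2)^{\otimes(n+1)}$ be two $(n+1)$-qubit states such that for every subsystem $i\in\{1,\dots,n+1\}$ the polynomials defining the roots of $E$ for the $i$-th subsystem of $|\psi\rangle$ and of $|\phi\rangle$ are not identically zero, and the root sets $\Lambda_i(\psi)$ and $\Lambda_i(\phi)$ each contain at least $3$ distinct points. Then $|\psi\rangle$ and $|\phi\rangle$ are SLOCC-equivalent if and only if there is an operator $\mathcal O\in\mathrm{Out}_E(\psi,\phi)$ with $\mathcal O|\psi\rangle\propto|\phi\rangle$.
   Context: A $\mathrm{SLIP}_n^h$ measure is an entanglement measure $E$ on $n$-qubit vectors that is a homogeneous polynomial of degree $h\ge1$ in the coefficients of the state (possibly up to taking the absolute value of such a polynomial) and is invariant under every $\mathcal O_1\otimes\cdots\otimes\mathcal O_n$ with $\mathcal O_i\in\mathrm{SL}(2,\mathbb C)$. Two $(n+1)$-qubit states are SLOCC-equivalent if $\mathcal O|\psi\rangle\propto|\phi\rangle$ (nonzero proportionality constant) for some $\mathcal O=\mathcal O_1\otimes\cdots\otimes\mathcal O_{n+1}$ with all $\mathcal O_i\in\mathrm{SL}(2,\mathbb C)$. Roots: for each $i$, write $|\psi\rangle=|0\rangle_i|\psi^{(i)}_0\rangle+|1\rangle_i|\psi^{(i)}_1\rangle$, where the subscript $i$ denotes the $i$-th qubit and $|\psi^{(i)}_0\rangle,|\psi^{(i)}_1\rangle\in(\mathbb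 C^2)^{\otimes n}$ are (unnormalized) vectors of the other $n$ qubits, kept in their order. $\Lambda_i(\psi)\subset\hat{\mathbb C}=\mathbb C\cup\{\infty\}$ is the set of distinct roots $z$ of the polynomial $E(z|\psi^{(i)}_0\rangle+|\psi^{(i)}_1\rangle)$, regarded as of formal degree $h$ (so $\infty\in\Lambda_i(\psi)$ iff $E(|\psi^{(i)}_0\rangle)=0$). Convention: the matrix $\begin{pmatrix}a&b\\c&d\end{pmatrix}$ acts on a qubit by $|0\rangle\mapsto a|0\rangle+b|1\rangle$, $|1\rangle\mapsto c|0\rangle+d|1\rangle$. The map on roots associated to $\mathcal O=\begin{pmatrix}a&b\\c&d\end{pmatrix}$ is the Möbius transformation $T_{\mathcal O}(z)=\frac{dz-b}{-cz+a}$; every Möbius transformation equals $T_{\mathcal O}$ for some $\mathcal O\in\mathrm{SL}(2,\mathbb C)$, unique up to sign. Output of the procedure: $\mathrm{Out}_E(\psi,\phi)$ is the set of all $\mathcal O_1\otimes\cdots\otimes\mathcal O_{n+1}$ with $\mathcal O_i\in\mathrm{SL}(2,\mathbb C)$ such that, for every $i$, the Möbius transformation $T_{\mathcal O_i}$ maps $\Lambda_i(\psi)$ onto $\Lambda_i(\phi)$ (it is empty if $|\Lambda_i(\psi)|\neq|\Lambda_i(\phi)|$ for some $i$). *)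

theory Defs
  imports "HOL-Analysis.Analysis"
begin

text \<open>
  The computational basis of \<open>n\<close> qubits is indexed by bit lists of length \<open>n\<close>, with
  \<^const>\<open>False\<close> for \<open>|0>\<close> and \<^const>\<open>True\<close> for \<open>|1>\<close>.  A vector is its coefficient function,
  extended by \<open>0\<close> to bit lists of other lengths.  Qubits are numbered from \<open>0\<close>.
\<close>

type_synonym qvec = "bool list \<Rightarrow> complex"

definition basis :: "nat \<Rightarrow> bool list set"
  where "basis n = {x. length x = n}"

definition qubits :: "nat \<Rightarrow> qvec set"
  where "qubits n = {\<psi>. \<forall>x. x \<notin> basis n \<longrightarrow> \<psi> x = 0}"

lemma finite_basis: "finite (basis n)"
  unfolding basis_def using finite_lists_length_eq[of "UNIV :: bool set" n] by simp

definition SL2 :: "(complex^2^2) set"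
  where "SL2 = {A. det A = 1}"

definition bit_index :: "bool \<Rightarrow> 2"
  where "bit_index b = (if b then 2 else 1)"

text \<open>
  A matrix with rows \<open>(a, b)\<close> and \<open>(c, d)\<close> acts by \<open>|0> \<mapsto> a|0> + b|1>\<close> and
  \<open>|1> \<mapsto> c|0> + d|1>\<close>: the row index is the input bit and the column index the output bit,
  so this is the transpose of the usual action on coordinate columns.
  \<open>tensor_op n A\<close> is \<open>A 0 \<otimes> \<dots> \<otimes> A (n - 1)\<close>.
\<close>

definition tensor_op :: "nat \<Rightarrow> (nat \<Rightarrow> complex^2^2) \<Rightarrow> qvec \<Rightarrow> qvec"
  where "tensor_op n A \<psi> =
    (\<lambda>y. if y \<in> basis n
         then \<Sum>x\<in>basis n. (\<Prod>i<n. A i $ bit_index (x ! i) $ bit_index (y ! i)) * \<psi> x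
         else 0)"

definition proportional :: "qvec \<Rightarrow> qvec \<Rightarrow> bool"
  where "proportional \<psi> \<phi> \<longleftrightarrow> (\<exists>c. c \<noteq> 0 \<and> \<psi> = (\<lambda>x. c * \<phi> x))"

definition SLOCC_equivalent :: "nat \<Rightarrow> qvec \<Rightarrow> qvec \<Rightarrow> bool"
  where "SLOCC_equivalent n \<psi> \<phi> \<longleftrightarrow>
    (\<exists>A. (\<forall>i<n. A i \<in> SL2) \<and> proportional (tensor_op n A \<psi>) \<phi>)"

text \<open>Multidegrees of the monomials of total degree \<open>h\<close> in the \<open>2 ^ n\<close> coefficients.\<close>

definition multidegrees :: "nat \<Rightarrow> nat \<Rightarrow> (bool list \<Rightarrow> nat) set"
  where "multidegrees n h = {\<alpha> \<in> basis n \<rightarrow>\<^sub>E {0..h}. (\<Sum>x\<in>basis n. \<alpha> x) = h}"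

lemma finite_multidegrees: "finite (multidegrees n h)"
  unfolding multidegrees_def by (simp add: finite_PiE finite_basis)

definition homogeneous_polynomial :: "nat \<Rightarrow> nat \<Rightarrow> (qvec \<Rightarrow> complex) \<Rightarrow> bool"
  where "homogeneous_polynomial n h P \<longleftrightarrow>
    (\<exists>c. \<forall>\<psi>\<in>qubits n.
       P \<psi> = (\<Sum>\<alpha>\<in>multidegrees n h. c \<alpha> * (\<Prod>x\<in>basis n. \<psi> x ^ \<alpha> x)))"

text \<open>
  The second alternative covers measures that are absolute values of polynomials; their real
  values are embedded in the complex numbers.  Invariance is required of \<open>E\<close> itself, not of \<open>P\<close>.
\<close>

definition SLIP :: "nat \<Rightarrow> nat \<Rightarrow> (qvec \<Rightarrow> complex) \<Rightarrow> bool"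
  where "SLIP n h E \<longleftrightarrow>
    1 \<le> h \<and>
    (\<exists>P. homogeneous_polynomial n h P \<and>
       ((\<forall>\<psi>\<in>qubits n. E \<psi> = P \<psi>) \<or> (\<forall>\<psi>\<in>qubits n. E \<psi> = complex_of_real (cmod (P \<psi>))))) \<and>
    (\<forall>A. (\<forall>i<n. A i \<in> SL2) \<longrightarrow> (\<forall>\<psi>\<in>qubits n. E (tensor_op n A \<psi>) = E \<psi>))"

text \<open>\<open>slice i b \<psi>\<close> is the vector \<open>|\<psi>\<^sub>b>\<close> of the other qubits in \<open>|\<psi>> = |0>\<^sub>i |\<psi>\<^sub>0> + |1>\<^sub>i |\<psi>\<^sub>1>\<close>.\<close>

definition slice :: "nat \<Rightarrow> bool \<Rightarrow> qvec \<Rightarrow> qvec"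
  where "slice i b \<psi> = (\<lambda>x. \<psi> (take i x @ b # drop i x))"

text \<open>
  When \<open>E\<close> is the absolute value of a polynomial, \<open>root_poly\<close> is the absolute value of the
  polynomial meant, which has the same zeros.
\<close>

definition root_poly :: "(qvec \<Rightarrow> complex) \<Rightarrow> nat \<Rightarrow> qvec \<Rightarrow> complex \<Rightarrow> complex"
  where "root_poly E i \<psi> z = E (\<lambda>x. z * slice i False \<psi> x + slice i True \<psi> x)"

text \<open>The Riemann sphere is \<^typ>\<open>complex option\<close>, with \<^const>\<open>None\<close> as the point at infinity.
  Infinity is a root iff the coefficient of formal degree \<open>h\<close>, which is \<open>E |\<psi>\<^sub>0>\<close>, vanishes.\<close>

definition roots :: "(qvec \<Rightarrow> complex) \<Rightarrow> nat \<Rightarrow> qvec \<Rightarrow> complex option set"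
  where "roots E i \<psi> =
    Some ` {z. root_poly E i \<psi> z = 0} \<union> (if E (slice i False \<psi>) = 0 then {None} else {})"

fun moebius :: "complex^2^2 \<Rightarrow> complex option \<Rightarrow> complex option"
  where
    "moebius A (Some z) =
      (if - (A $ 2 $ 1) * z + A $ 1 $ 1 = 0 then None
       else Some ((A $ 2 $ 2 * z - A $ 1 $ 2) / (- (A $ 2 $ 1) * z + A $ 1 $ 1)))"
  | "moebius A None =
      (if A $ 2 $ 1 = 0 then None else Some (A $ 2 $ 2 / - (A $ 2 $ 1)))"

definition Out :: "nat \<Rightarrow> (qvec \<Rightarrow> complex) \<Rightarrow> qvec \<Rightarrow> qvec \<Rightarrow> (qvec \<Rightarrow> qvec) set"
  where "Out m E \<psi> \<phi> =
    {tensor_op m A | A. \<forall>i<m. A i \<in> SL2 \<and> moebius (A i) ` roots E i \<psi> = roots E i \<phi>}"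

end

theory Submission imports Defs begin

text \<open>
  If \<open>A\<^sub>0 \<otimes> \<dots> \<otimes> A\<^sub>n\<close> maps \<open>\<psi>\<close> to a multiple of \<open>\<phi>\<close>, then \<open>A\<^sub>i\<close> acts linearly on the pencil
  spanned by the two \<open>i\<close>-th slices, while the other factors act on the slices by an operator
  that leaves \<open>E\<close> invariant.  In homogeneous coordinates the zero set of \<open>E\<close> on the pencil of
  \<open>\<phi>\<close> is therefore the image of the one of \<open>\<psi>\<close> under a linear change of coordinates,
  and this change of coordinates is \<open>moebius (A i)\<close>.  So any operator witnessing the
  equivalence already belongs to \<open>Out\<close>.
\<close>

definition insert_at :: "nat \<Rightarrow> 'a \<Rightarrow> 'a list \<Rightarrow> 'a list"
  where "insert_at i b x = take i x @ b # drop i x"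

text \<open>Enumerates in order the indices other than \<open>i\<close>: the qubit numbered
  \<open>j\<close> after qubit \<open>i\<close> is split off was numbered \<open>skip i j\<close>
  before.\<close>

definition skip :: "nat \<Rightarrow> nat \<Rightarrow> nat"
  where "skip i j = (if j < i then j else Suc j)"

lemma length_insert_at [simp]: "length (insert_at i b x) = Suc (length x)"
  by (simp add: insert_at_def)

lemma nth_insert_at_self: "i \<le> length x \<Longrightarrow> insert_at i b x ! i = b"
  by (simp add: insert_at_def nth_append)

lemma nth_insert_at_skip:
  "i \<le> length x \<Longrightarrow> j < length x \<Longrightarrow> insert_at i b x ! skip i j = x ! j"
  by (auto simp: insert_at_def skip_def nth_append min_def nth_Cons' Suc_diff_le)

lemma insert_at_nth_self:
  assumes "i < length y"
  shows "insert_at i (y ! i) (take i y @ drop (Suc i) y) = y"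
  using assms by (simp add: insert_at_def id_take_nth_drop[symmetric])

lemma bij_betw_insert_at:
  assumes "i \<le> n"
  shows "bij_betw (\<lambda>(b, x). insert_at i b x) (UNIV \<times> basis n) (basis (Suc n))"
proof (rule bij_betwI[where g = "\<lambda>y. (y ! i, take i y @ drop (Suc i) y)"])
  show "(\<lambda>(b, x). insert_at i b x) \<in> UNIV \<times> basis n \<rightarrow> basis (Suc n)"
    by (auto simp: basis_def)
  show "(\<lambda>y. (y ! i, take i y @ drop (Suc i) y)) \<in> basis (Suc n) \<rightarrow> UNIV \<times> basis n"
    using assms by (auto simp: basis_def)
qed (use assms in \<open>auto simp: basis_def insert_at_nth_self nth_insert_at_self\<close>,
     auto simp: insert_at_def)

lemma sum_basis_Suc:
  fixes f :: "bool list \<Rightarrow> complex"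
  assumes "i \<le> n"
  shows "(\<Sum>y\<in>basis (Suc n). f y) =
    (\<Sum>x\<in>basis n. f (insert_at i False x)) + (\<Sum>x\<in>basis n. f (insert_at i True x))"
proof -
  have "(\<Sum>y\<in>basis (Suc n). f y) = (\<Sum>(b, x)\<in>UNIV \<times> basis n. f (insert_at i b x))"
    using sum.reindex_bij_betw[OF bij_betw_insert_at[OF assms], of f]
    by (simp add: case_prod_unfold)
  also have "\<dots> = (\<Sum>b\<in>UNIV. \<Sum>x\<in>basis n. f (insert_at i b x))"
    by (simp add: sum.cartesian_product)
  finally show ?thesis
    by (simp add: UNIV_bool)
qed

lemma prod_lessThan_skip:
  fixes f :: "nat \<Rightarrow> complex"
  assumes "i \<le> n"
  shows "(\<Prod>j<Suc n. f j) = f i * (\<Prod>j<n. f (skip i j))"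
proof -
  have "bij_betw (skip i) {..<n} ({..<Suc n} - {i})"
    by (rule bij_betwI[where g = "\<lambda>j. if j < i then j else j - 1"])
       (use assms in \<open>auto simp: skip_def split: if_splits\<close>)
  then have "(\<Prod>j\<in>{..<Suc n} - {i}. f j) = (\<Prod>j<n. f (skip i j))"
    by (simp add: prod.reindex_bij_betw)
  then show ?thesis
    using assms by (subst prod.remove[of _ i]) auto
qed

lemma slice_eq: "slice i b \<psi> x = \<psi> (insert_at i b x)"
  by (simp add: slice_def insert_at_def)

lemma slice_qubits: "\<psi> \<in> qubits (Suc n) \<Longrightarrow> slice i b \<psi> \<in> qubits n"
  by (auto simp: qubits_def slice_eq basis_def)

lemma tensor_op_linear:
  "tensor_op n A (\<lambda>x. u * \<psi> x + v * \<phi> x) y = u * tensor_op n A \<psi> y + v * tensor_op n A \<phi> y"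
  by (simp add: tensor_op_def sum_distrib_left sum.distrib[symmetric] algebra_simps)

text \<open>The sum over input strings splits by the value of bit \<open>i\<close>, and the product
  over qubits splits off its factor at \<open>i\<close>. The input bit selects the row of
  \<open>A i\<close>, the fixed output bit \<open>b\<close> its column; the other factors form the
  operator of \<open>A \<circ> skip i\<close>.\<close>

lemma slice_tensor_op:
  assumes "i \<le> n"
  shows "slice i b (tensor_op (Suc n) A \<psi>) y =
    A i $ 1 $ bit_index b * tensor_op n (A \<circ> skip i) (slice i False \<psi>) y +
    A i $ 2 $ bit_index b * tensor_op n (A \<circ> skip i) (slice i True \<psi>) y"
proof (cases "y \<in> basis n")
  case True
  then have y: "insert_at i b y \<in> basis (Suc n)"
    by (simp add: basis_def)
  have bits: "bit_index False = 1" "bit_index True = 2"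
    by (simp_all add: bit_index_def)
  have prod_eq: "(\<Prod>j<Suc n. A j $ bit_index (insert_at i s x ! j) $ bit_index (insert_at i b y ! j)) =
      A i $ bit_index s $ bit_index b *
      (\<Prod>j<n. (A \<circ> skip i) j $ bit_index (x ! j) $ bit_index (y ! j))"
    if "x \<in> basis n" for s x
    using True that assms
    by (subst prod_lessThan_skip[OF assms])
       (simp add: basis_def nth_insert_at_self nth_insert_at_skip)
  show ?thesis
    using True y
    by (simp del: prod.lessThan_Suc
             add: slice_eq tensor_op_def sum_basis_Suc[OF assms] prod_eq bits
                  sum_distrib_left mult.assoc)
next
  case False
  then show ?thesis
    by (simp add: slice_eq tensor_op_def basis_def)
qed

text \<open>The exponents of each monomial sum to \<open>h\<close>, so the underlying polynomial
  scales by \<open>k ^ h\<close>. Speaking only of zeros treats a polynomial and its absolute value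
  alike.\<close>

lemma SLIP_scale_eq_0_iff:
  assumes "SLIP n h E" and "\<psi> \<in> qubits n" and "k \<noteq> 0"
  shows "E (\<lambda>x. k * \<psi> x) = 0 \<longleftrightarrow> E \<psi> = 0"
proof -
  obtain P where P: "homogeneous_polynomial n h P"
    and E: "(\<forall>\<psi>\<in>qubits n. E \<psi> = P \<psi>) \<or> (\<forall>\<psi>\<in>qubits n. E \<psi> = complex_of_real (cmod (P \<psi>)))"
    using assms(1) unfolding SLIP_def by blast
  have zero: "E \<xi> = 0 \<longleftrightarrow> P \<xi> = 0" if "\<xi> \<in> qubits n" for \<xi>
    using E that by auto
  obtain c where c: "\<And>\<xi>. \<xi> \<in> qubits n \<Longrightarrow>
      P \<xi> = (\<Sum>\<alpha>\<in>multidegrees n h. c \<alpha> * (\<Prod>x\<in>basis n. \<xi> x ^ \<alpha> x))"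
    using P unfolding homogeneous_polynomial_def by blast
  have k\<psi>: "(\<lambda>x. k * \<psi> x) \<in> qubits n"
    using assms(2) by (simp add: qubits_def)
  have "(\<Prod>x\<in>basis n. (k * \<psi> x) ^ \<alpha> x) = k ^ h * (\<Prod>x\<in>basis n. \<psi> x ^ \<alpha> x)"
    if "\<alpha> \<in> multidegrees n h" for \<alpha>
    using that by (simp add: power_mult_distrib prod.distrib power_sum[symmetric] multidegrees_def)
  then have "P (\<lambda>x. k * \<psi> x) = k ^ h * P \<psi>"
    by (simp add: c[OF k\<psi>] c[OF assms(2)] sum_distrib_left mult.left_commute)
  then show ?thesis
    using assms(3) zero[OF k\<psi>] zero[OF assms(2)] by simp
qed

text \<open>The point of the projective line with homogeneous coordinates \<open>[u : v]\<close>.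
  The pair \<open>(0, 0)\<close> represents no point, although it is sent to \<open>None\<close>
  here; hence the assumption \<open>u \<noteq> 0 \<or> v \<noteq> 0\<close> below.\<close>

definition sphere_point :: "complex \<Rightarrow> complex \<Rightarrow> complex option"
  where "sphere_point u v = (if v = 0 then None else Some (u / v))"

lemma sphere_point_cases:
  obtains u v where "p = sphere_point u v" and "u \<noteq> 0 \<or> v \<noteq> 0"
proof (cases p)
  case None
  then show ?thesis using that[of 1 0] by (simp add: sphere_point_def)
next
  case (Some z)
  then show ?thesis using that[of z 1] by (simp add: sphere_point_def)
qed

text \<open>For determinant 1 the adjugate is the inverse: the first two identities apply
  \<open>A\<close> after its adjugate, the last two the adjugate after \<open>A\<close>.\<close>

lemma det_2_invert:
  fixes A :: "complex^2^2"
  assumes "det A = 1"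
  shows "A$1$1 * (A$2$2 * u - A$1$2 * v) + A$1$2 * (A$1$1 * v - A$2$1 * u) = u"
    and "A$2$1 * (A$2$2 * u - A$1$2 * v) + A$2$2 * (A$1$1 * v - A$2$1 * u) = v"
    and "A$2$2 * (A$1$1 * u + A$1$2 * v) - A$1$2 * (A$2$1 * u + A$2$2 * v) = u"
    and "A$1$1 * (A$2$1 * u + A$2$2 * v) - A$2$1 * (A$1$1 * u + A$1$2 * v) = v"
proof -
  have d: "A$1$1 * A$2$2 - A$1$2 * A$2$1 = 1"
    using assms by (simp add: det_2)
  show "A$1$1 * (A$2$2 * u - A$1$2 * v) + A$1$2 * (A$1$1 * v - A$2$1 * u) = u"
    "A$2$1 * (A$2$2 * u - A$1$2 * v) + A$2$2 * (A$1$1 * v - A$2$1 * u) = v"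
    "A$2$2 * (A$1$1 * u + A$1$2 * v) - A$1$2 * (A$2$1 * u + A$2$2 * v) = u"
    "A$1$1 * (A$2$1 * u + A$2$2 * v) - A$2$1 * (A$1$1 * u + A$1$2 * v) = v"
    using d by algebra+
qed

text \<open>Clearing the denominator \<open>v\<close> turns the fractional map into the linear
  action of the adjugate of \<open>A\<close>, which needs no special case at infinity.\<close>

lemma moebius_sphere_point:
  assumes "det A = 1" and "u \<noteq> 0 \<or> v \<noteq> 0"
  shows "moebius A (sphere_point u v) =
    sphere_point (A$2$2 * u - A$1$2 * v) (A$1$1 * v - A$2$1 * u)"
proof (cases "v = 0")
  case True
  then show ?thesis
    using assms by (auto simp: sphere_point_def field_simps)
next
  case False
  then have "- (A$2$1) * (u / v) + A$1$1 = (A$1$1 * v - A$2$1 * u) / v"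
    and "A$2$2 * (u / v) - A$1$2 = (A$2$2 * u - A$1$2 * v) / v"
    by (simp_all add: field_simps)
  with False show ?thesis
    by (simp add: sphere_point_def del: mult_minus_left)
qed

text \<open>By homogeneity a root is a zero of \<open>E\<close> on the pencil of the two slices:
  divide by \<open>v\<close> at finite points and by \<open>u\<close> at infinity.\<close>

lemma sphere_point_mem_roots_iff:
  assumes "SLIP n h E" and "\<psi> \<in> qubits (Suc n)" and "u \<noteq> 0 \<or> v \<noteq> 0"
  shows "sphere_point u v \<in> roots E i \<psi> \<longleftrightarrow>
    E (\<lambda>x. u * slice i False \<psi> x + v * slice i True \<psi> x) = 0"
proof (cases "v = 0")
  case True
  then show ?thesis
    using SLIP_scale_eq_0_iff[OF assms(1) slice_qubits[OF assms(2)], of u i False] assms(3)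
    by (auto simp: sphere_point_def roots_def)
next
  case False
  have q: "(\<lambda>x. u / v * slice i False \<psi> x + slice i True \<psi> x) \<in> qubits n"
    using slice_qubits[OF assms(2), of i] by (simp add: qubits_def)
  have "(\<lambda>x. v * (u / v * slice i False \<psi> x + slice i True \<psi> x)) =
      (\<lambda>x. u * slice i False \<psi> x + v * slice i True \<psi> x)"
    using False by (simp add: distrib_left)
  then show ?thesis
    using SLIP_scale_eq_0_iff[OF assms(1) q False] False
    by (auto simp: sphere_point_def roots_def root_poly_def)
qed

lemma moebius_mem_roots_iff:
  assumes E: "SLIP n h E"
    and \<psi>: "\<psi> \<in> qubits (Suc n)" and \<phi>: "\<phi> \<in> qubits (Suc n)"
    and A: "\<And>j. j < Suc n \<Longrightarrow> A j \<in> SL2"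
    and equiv: "proportional (tensor_op (Suc n) A \<psi>) \<phi>"
    and i: "i \<le> n"
  shows "moebius (A i) p \<in> roots E i \<phi> \<longleftrightarrow> p \<in> roots E i \<psi>"
proof -
  obtain u v where p: "p = sphere_point u v" and uv: "u \<noteq> 0 \<or> v \<noteq> 0"
    by (rule sphere_point_cases)
  obtain k where k: "k \<noteq> 0" and eq: "tensor_op (Suc n) A \<psi> = (\<lambda>x. k * \<phi> x)"
    using equiv unfolding proportional_def by blast
  have det: "det (A i) = 1"
    using A[of i] i by (simp add: SL2_def)
  \<comment> \<open>Homogeneous coordinates of \<open>moebius (A i) p\<close>. They are not both
    zero, since \<open>A i\<close> maps them back to \<open>(u, v)\<close>.\<close>
  define w1 where "w1 = A i $2$2 * u - A i $1$2 * v"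
  define w2 where "w2 = A i $1$1 * v - A i $2$1 * u"
  have inverse_eqs: "A i $1$1 * w1 + A i $1$2 * w2 = u" "A i $2$1 * w1 + A i $2$2 * w2 = v"
    unfolding w1_def w2_def by (rule det_2_invert[OF det])+
  then have w: "w1 \<noteq> 0 \<or> w2 \<noteq> 0"
    using uv by auto
  define \<psi>' where "\<psi>' = (\<lambda>x. u * slice i False \<psi> x + v * slice i True \<psi> x)"
  define \<phi>' where "\<phi>' = (\<lambda>x. w1 * slice i False \<phi> x + w2 * slice i True \<phi> x)"
  have \<psi>'q: "\<psi>' \<in> qubits n"
    using slice_qubits[OF \<psi>, of i] by (simp add: \<psi>'_def qubits_def)
  have \<phi>'q: "\<phi>' \<in> qubits n"
    using slice_qubits[OF \<phi>, of i] by (simp add: \<phi>'_def qubits_def)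
  let ?B = "tensor_op n (A \<circ> skip i)"
  have slices: "k * slice i b \<phi> y =
      A i $ 1 $ bit_index b * ?B (slice i False \<psi>) y + A i $ 2 $ bit_index b * ?B (slice i True \<psi>) y"
    for b y
    using slice_tensor_op[OF i, of b A \<psi> y] by (simp add: eq slice_eq)
  \<comment> \<open>Expanding the slices of \<phi> applies \<open>A i\<close> to
    \<open>(w1, w2)\<close>, which undoes the adjugate and leaves the pencil of \<psi> at
    \<open>(u, v)\<close>, acted on by the other factors.\<close>
  have "k * \<phi>' y = ?B \<psi>' y" for y
  proof -
    have "k * \<phi>' y = w1 * (k * slice i False \<phi> y) + w2 * (k * slice i True \<phi> y)"
      by (simp add: \<phi>'_def algebra_simps)
    also have "\<dots> = (A i $1$1 * w1 + A i $1$2 * w2) * ?B (slice i False \<psi>) y +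
        (A i $2$1 * w1 + A i $2$2 * w2) * ?B (slice i True \<psi>) y"
      by (simp add: slices bit_index_def algebra_simps)
    also have "\<dots> = ?B \<psi>' y"
      by (simp add: inverse_eqs \<psi>'_def tensor_op_linear)
    finally show ?thesis .
  qed
  then have "(\<lambda>y. k * \<phi>' y) = ?B \<psi>'"
    by blast
  moreover have "E (?B \<psi>') = E \<psi>'"
  proof -
    have "\<forall>j<n. (A \<circ> skip i) j \<in> SL2"
      using A by (simp add: skip_def)
    then show ?thesis
      using E \<psi>'q unfolding SLIP_def by blast
  qed
  ultimately have "E \<phi>' = 0 \<longleftrightarrow> E \<psi>' = 0"
    using SLIP_scale_eq_0_iff[OF E \<phi>'q k] by simp
  then show ?thesis
    using sphere_point_mem_roots_iff[OF E \<psi> uv, of i] sphere_point_mem_roots_iff[OF E \<phi> w, of i]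
      moebius_sphere_point[OF det uv]
    by (simp add: p \<psi>'_def \<phi>'_def w1_def w2_def)
qed

text \<open>Upgrades the preimage description of root sets to the image required in
  \<open>Out\<close>. A preimage of \<open>[u : v]\<close> is obtained by applying \<open>A\<close>
  to its coordinates.\<close>

lemma surj_moebius:
  assumes "det A = 1"
  shows "surj (moebius A)"
unfolding surj_def
proof (rule allI)
  fix q
  obtain u v where q: "q = sphere_point u v" and uv: "u \<noteq> 0 \<or> v \<noteq> 0"
    by (rule sphere_point_cases)
  define w1 where "w1 = A$1$1 * u + A$1$2 * v"
  define w2 where "w2 = A$2$1 * u + A$2$2 * v"
  have inverse_eqs: "A$2$2 * w1 - A$1$2 * w2 = u" "A$1$1 * w2 - A$2$1 * w1 = v"
    unfolding w1_def w2_def by (rule det_2_invert[OF assms])+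
  then have "w1 \<noteq> 0 \<or> w2 \<noteq> 0"
    using uv by auto
  from moebius_sphere_point[OF assms this] show "\<exists>p. q = moebius A p"
    unfolding inverse_eqs q by metis
qed

theorem proposition1:
  fixes n h :: nat and E :: "qvec \<Rightarrow> complex" and \<psi> \<phi> :: qvec
  assumes "n \<ge> 1" and "h \<ge> 3"
    and "SLIP n h E"
    and "\<psi> \<in> qubits (n + 1)" and "\<phi> \<in> qubits (n + 1)"
    and "\<And>i. i < n + 1 \<Longrightarrow> \<exists>z. root_poly E i \<psi> z \<noteq> 0"
    and "\<And>i. i < n + 1 \<Longrightarrow> \<exists>z. root_poly E i \<phi> z \<noteq> 0"
    and "\<And>i. i < n + 1 \<Longrightarrow> card (roots E i \<psi>) \<ge> 3"
    and "\<And>i. i < n + 1 \<Longrightarrow> card (roots E i \<phi>) \<ge> 3"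
  shows "SLOCC_equivalent (n + 1) \<psi> \<phi> \<longleftrightarrow>
         (\<exists>T \<in> Out (n + 1) E \<psi> \<phi>. proportional (T \<psi>) \<phi>)"
proof
  assume "SLOCC_equivalent (n + 1) \<psi> \<phi>"
  then obtain A where A: "\<And>i. i < Suc n \<Longrightarrow> A i \<in> SL2"
    and equiv: "proportional (tensor_op (Suc n) A \<psi>) \<phi>"
    unfolding SLOCC_equivalent_def by auto
  have "moebius (A i) ` roots E i \<psi> = roots E i \<phi>" if "i < Suc n" for i
  proof -
    have "roots E i \<psi> = moebius (A i) -` roots E i \<phi>"
      using moebius_mem_roots_iff[OF assms(3) _ _ A equiv, of i] assms(4,5) that by auto
    moreover have "surj (moebius (A i))"
      using A[OF that] by (simp add: SL2_def surj_moebius)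
    ultimately show ?thesis
      by (simp add: surj_image_vimage_eq)
  qed
  then have "tensor_op (n + 1) A \<in> Out (n + 1) E \<psi> \<phi>"
    using A unfolding Out_def Suc_eq_plus1[symmetric] by blast
  then show "\<exists>T \<in> Out (n + 1) E \<psi> \<phi>. proportional (T \<psi>) \<phi>"
    using equiv by auto
next
  assume "\<exists>T \<in> Out (n + 1) E \<psi> \<phi>. proportional (T \<psi>) \<phi>"
  \<comment> \<open>Every member of \<open>Out\<close> is a tensor product of \<open>SL2\<close>
    factors, hence itself a witness.\<close>
  then show "SLOCC_equivalent (n + 1) \<psi> \<phi>"
    unfolding SLOCC_equivalent_def Out_def by auto
qed

end
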